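(* Let $X$ be a reflexive Banach space and $A$ be the generator of a $C_0$ semigroup $T(t)$ on it. Let $\mathcal{N}$ be a Hilbert space and $C:X\to\mathcal{N}$ be a bounded operator. If the pair $(C,A)$ is continuously finally observable on $[0,t_0]$ for some $t_0>0$, then it is detectable in $L^2$.
   Context: $(C,A)$ is continuously finally observable on $[0,t_0]$ (at time $t_0$) if there exists $\varepsilon>0$ such that $\int_0^{t_0}\|CT(t)x\|^2\,dt\ge\varepsilon\|T(t_0)x\|^2$ for all $x\in X$. $(C,A)$ is detectable in $L^2$ if for all $x\in X$: $\int_0^\infty\|CT(t)x\|^2\,dt<\infty$ implies $\int_0^\infty\|T(t)x\|^2\,dt<\infty$. *)

theory Defs
  imports "HOL-Analysis.Analysis"
begin

text \<open>
  All spaces are real. A complex Banach or Hilbert space is covered by restricting scalars (with the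
  real part of the inner product): norms, bounded operators, semigroups, generators and reflexivity
  are unaffected.
\<close>

definition reflexive_space :: "'a::real_normed_vector itself \<Rightarrow> bool" where
  "reflexive_space _ \<longleftrightarrow>
     (\<forall>\<phi> :: ('a \<Rightarrow>\<^sub>L real) \<Rightarrow>\<^sub>L real. \<exists>x. \<forall>f. blinfun_apply \<phi> f = blinfun_apply f x)"

text \<open>Only the values \<open>T t\<close> with \<open>t \<ge> 0\<close> are constrained.\<close>

definition C0_semigroup :: "(real \<Rightarrow> 'a::real_normed_vector \<Rightarrow>\<^sub>L 'a) \<Rightarrow> bool" where
  "C0_semigroup T \<longleftrightarrow>
     T 0 = id_blinfun \<and>
     (\<forall>s\<ge>0. \<forall>t\<ge>0. T (s + t) = T s o\<^sub>L T t) \<and>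
     (\<forall>x. ((\<lambda>t. blinfun_apply (T t) x) \<longlongrightarrow> x) (at_right 0))"

text \<open>
  The possibly unbounded operator with domain \<open>D\<close> and values \<open>A x\<close> for \<open>x \<in> D\<close>; the values of
  \<open>A\<close> outside \<open>D\<close> are irrelevant.
\<close>

definition is_generator ::
  "'a set \<Rightarrow> ('a \<Rightarrow> 'a) \<Rightarrow> (real \<Rightarrow> 'a::real_normed_vector \<Rightarrow>\<^sub>L 'a) \<Rightarrow> bool" where
  "is_generator D A T \<longleftrightarrow>
     D = {x. \<exists>y. ((\<lambda>h. (blinfun_apply (T h) x - x) /\<^sub>R h) \<longlongrightarrow> y) (at_right 0)} \<and>
     (\<forall>x\<in>D. ((\<lambda>h. (blinfun_apply (T h) x - x) /\<^sub>R h) \<longlongrightarrow> A x) (at_right 0))"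

text \<open>
  The properties of the pair \<open>(C, A)\<close> involve \<open>A\<close> only through the semigroup it generates, so they
  are stated for \<open>C\<close> and \<open>T\<close>.
\<close>

definition continuously_finally_observable ::
  "('a::real_normed_vector \<Rightarrow>\<^sub>L 'n::real_normed_vector) \<Rightarrow> (real \<Rightarrow> 'a \<Rightarrow>\<^sub>L 'a) \<Rightarrow> real \<Rightarrow> bool" where
  "continuously_finally_observable C T t\<^sub>0 \<longleftrightarrow>
     (\<exists>\<epsilon>>0. \<forall>x.
        (\<integral>\<^sup>+t\<in>{0..t\<^sub>0}. ennreal ((norm (blinfun_apply C (blinfun_apply (T t) x)))\<^sup>2) \<partial>lborel)
          \<ge> ennreal (\<epsilon> * (norm (blinfun_apply (T t\<^sub>0) x))\<^sup>2))"

definition detectable_L2 ::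
  "('a::real_normed_vector \<Rightarrow>\<^sub>L 'n::real_normed_vector) \<Rightarrow> (real \<Rightarrow> 'a \<Rightarrow>\<^sub>L 'a) \<Rightarrow> bool" where
  "detectable_L2 C T \<longleftrightarrow>
     (\<forall>x.
        (\<integral>\<^sup>+t\<in>{0..}. ennreal ((norm (blinfun_apply C (blinfun_apply (T t) x)))\<^sup>2) \<partial>lborel) < \<infinity> \<longrightarrow>
        (\<integral>\<^sup>+t\<in>{0..}. ennreal ((norm (blinfun_apply (T t) x))\<^sup>2) \<partial>lborel) < \<infinity>)"

end

theory Submission
  imports Defs
begin

text \<open>
  By the semigroup law, observability from the initial state \<open>T s x\<close> bounds
  \<open>\<epsilon> * (norm (T (s + t\<^sub>0) x))\<^sup>2\<close> by the integral of the squared output over \<open>{s..s + t\<^sub>0}\<close>.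
  Integrating over \<open>s \<ge> 0\<close>, each point of the output is counted for a set of \<open>s\<close> of measure at most
  \<open>t\<^sub>0\<close> (Tonelli), so the squared norm of the state is integrable over \<open>{t\<^sub>0..}\<close>. On \<open>{0..t\<^sub>0}\<close>
  it is bounded by the uniform boundedness principle, which also gives the continuity of orbits
  that makes all integrands measurable.
\<close>

text \<open>Baire category argument: the closed sets \<open>E n\<close> cover the complete space, so
  one of them contains a ball, and a uniform bound on a ball transfers to the origin by subtracting
  the centre.\<close>

lemma uniform_boundedness:
  fixes F :: "('a::banach \<Rightarrow>\<^sub>L 'b::real_normed_vector) set"
  assumes "\<And>x. \<exists>B. \<forall>f\<in>F. norm (blinfun_apply f x) \<le> B"
  shows "\<exists>M. \<forall>f\<in>F. norm f \<le> M"
proof -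
  define E where "E n = {x. \<forall>f\<in>F. norm (blinfun_apply f x) \<le> real n}" for n :: nat
  have closed: "closed (E n)" for n
  proof -
    have "E n = (\<Inter>f\<in>F. {x. norm (blinfun_apply f x) \<le> real n})"
      by (auto simp: E_def)
    then show ?thesis
      by (auto intro!: closed_INT closed_Collect_le continuous_intros)
  qed
  have cover: "(\<Union>n. E n) = UNIV"
  proof (intro equalityI subset_UNIV subsetI)
    fix x
    obtain B where B: "\<forall>f\<in>F. norm (blinfun_apply f x) \<le> B"
      using assms by blast
    obtain n where "B \<le> real n"
      using real_arch_simple by blast
    then have "x \<in> E n"
      using B by (auto simp: E_def intro: order_trans)
    then show "x \<in> (\<Union>n. E n)"
      by blast
  qed
  have "\<exists>n. interior (E n) \<noteq> {}"
  proof (rule ccontr)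
    assume "\<nexists>n. interior (E n) \<noteq> {}"
    then have "(euclidean :: 'a topology) interior_of \<Union>(range E) = {}"
      by (intro Baire_category_alt)
        (auto simp: closed interior_of_def interior_def completely_metrizable_space_euclidean)
    then show False
      by (simp add: cover)
  qed
  then obtain n a r where r: "r > 0" "cball a r \<subseteq> E n"
    by (meson all_not_in_conv mem_interior_cball)
  \<comment> \<open>The factor 2 comes from bounding \<open>f\<close> at both the centre
    \<open>a\<close> and the point \<open>a + u\<close>; dividing by \<open>r\<close> undoes the
    rescaling of \<open>x\<close> to norm \<open>r\<close>.\<close>
  have "norm f \<le> 2 * real n / r" if f: "f \<in> F" for f
  proof (rule norm_blinfun_bound)
    show "0 \<le> 2 * real n / r"
      using r by simp
    fix x
    show "norm (blinfun_apply f x) \<le> 2 * real n / r * norm x"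
    proof (cases "x = 0")
      case False
      define u where "u = (r / norm x) *\<^sub>R x"
      have "a + u \<in> cball a r" "a \<in> cball a r"
        using r False by (auto simp: u_def dist_norm)
      then have "norm (blinfun_apply f (a + u)) \<le> n" "norm (blinfun_apply f a) \<le> n"
        using r(2) f unfolding E_def by blast+
      moreover have "blinfun_apply f u = blinfun_apply f (a + u) - blinfun_apply f a"
        by (simp add: blinfun.add_right)
      ultimately have "norm (blinfun_apply f u) \<le> 2 * n"
        using norm_triangle_ineq4[of "blinfun_apply f (a + u)" "blinfun_apply f a"] by simp
      then have "r / norm x * norm (blinfun_apply f x) \<le> 2 * n"
        using r by (simp add: u_def blinfun.scaleR_right)
      then show ?thesis
        using r False by (simp add: field_simps)
    qed simp
  qed
  then show ?thesis by blast
qed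

lemma C0_semigroup_zero: "C0_semigroup T \<Longrightarrow> T 0 = id_blinfun"
  by (simp add: C0_semigroup_def)

lemma C0_semigroup_add:
  "C0_semigroup T \<Longrightarrow> 0 \<le> s \<Longrightarrow> 0 \<le> t \<Longrightarrow> T (s + t) = T s o\<^sub>L T t"
  by (simp add: C0_semigroup_def)

lemma C0_semigroup_tendsto:
  "C0_semigroup T \<Longrightarrow> ((\<lambda>t. blinfun_apply (T t) x) \<longlongrightarrow> x) (at_right 0)"
  by (simp add: C0_semigroup_def)

text \<open>Otherwise the norms blow up along some sequence of positive times tending to 0. Strong
  continuity at 0 makes every orbit converge along it, hence stay bounded, which contradicts uniform
  boundedness.\<close>

lemma C0_semigroup_bounded_near_0:
  fixes T :: "real \<Rightarrow> 'a::banach \<Rightarrow>\<^sub>L 'a"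
  assumes T: "C0_semigroup T"
  shows "\<exists>\<delta>>0. \<exists>M. \<forall>t\<in>{0..\<delta>}. norm (T t) \<le> M"
proof (rule ccontr)
  assume neg: "\<not> ?thesis"
  have "\<exists>t. 0 < t \<and> t \<le> inverse (real (Suc n)) \<and> real (Suc n) < norm (T t)" for n
  proof -
    have "inverse (real (Suc n)) > 0" by simp
    then obtain t where t: "t \<in> {0..inverse (real (Suc n))}" "real (Suc n) < norm (T t)"
      using neg not_le by blast
    \<comment> \<open>Strict positivity lets the sequence converge in \<open>at_right 0\<close>, the
      only filter for which the semigroup limit is given.\<close>
    have "t \<noteq> 0"
    proof
      assume "t = 0"
      then have "norm (T t) \<le> 1"
        by (simp add: C0_semigroup_zero[OF T] norm_blinfun_bound)
      then show False using t(2) by simp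
    qed
    with t show ?thesis by (auto simp: less_le)
  qed
  then have "\<exists>t. \<forall>n. 0 < t n \<and> t n \<le> inverse (real (Suc n)) \<and> real (Suc n) < norm (T (t n))"
    by (intro choice allI)
  then obtain t where t: "\<And>n. 0 < t n" "\<And>n. t n \<le> inverse (real (Suc n))"
    "\<And>n. real (Suc n) < norm (T (t n))"
    by blast
  have "t \<longlonglongrightarrow> 0"
    by (rule tendsto_sandwich[OF _ _ tendsto_const LIMSEQ_inverse_real_of_nat])
      (use t in \<open>auto intro!: always_eventually simp: less_imp_le\<close>)
  then have lim: "filterlim t (at_right 0) sequentially"
    using t(1) by (simp add: filterlim_at less_imp_neq[THEN not_sym])
  have "\<exists>M. \<forall>f\<in>range (\<lambda>n. T (t n)). norm f \<le> M"
  proof (rule uniform_boundedness)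
    fix x
    have "(\<lambda>n. blinfun_apply (T (t n)) x) \<longlonglongrightarrow> x"
      by (rule filterlim_compose[OF C0_semigroup_tendsto[OF T] lim])
    then have "Bseq (\<lambda>n. blinfun_apply (T (t n)) x)"
      by (intro convergent_imp_Bseq convergentI)
    then show "\<exists>B. \<forall>f\<in>range (\<lambda>n. T (t n)). norm (blinfun_apply f x) \<le> B"
      by (auto simp: Bseq_def)
  qed
  then obtain M where M: "\<And>n. norm (T (t n)) \<le> M" by blast
  obtain n where "M \<le> real n"
    using real_arch_simple by blast
  then show False
    using M[of n] t(3)[of n] by simp
qed

text \<open>The bound near 0 is propagated in steps of length \<open>\<delta>\<close>: by the
  semigroup law, each step costs at most a factor \<open>M\<close>.\<close>

lemma C0_semigroup_locally_bounded:
  fixes T :: "real \<Rightarrow> 'a::banach \<Rightarrow>\<^sub>L 'a"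
  assumes T: "C0_semigroup T"
  obtains M where "\<And>t. t \<in> {0..b} \<Longrightarrow> norm (T t) \<le> M"
proof -
  obtain \<delta> M where \<delta>: "\<delta> > 0" and M: "\<And>t. t \<in> {0..\<delta>} \<Longrightarrow> norm (T t) \<le> M"
    using C0_semigroup_bounded_near_0[OF T] by blast
  have "\<exists>K. \<forall>t\<in>{0..real n * \<delta>}. norm (T t) \<le> K" for n
  proof (induction n)
    case (Suc n)
    then obtain K where K: "\<And>t. t \<in> {0..real n * \<delta>} \<Longrightarrow> norm (T t) \<le> K" by blast
    have M0: "0 \<le> M" using order_trans[OF norm_ge_zero M[of 0]] \<delta> by simp
    have "norm (T t) \<le> max M (M * K)" if t: "t \<in> {0..real (Suc n) * \<delta>}" for t
    proof (cases "t \<le> \<delta>")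
      case True
      then show ?thesis using M[of t] t by (simp add: le_max_iff_disj)
    next
      case False
      then have "t - \<delta> \<in> {0..real n * \<delta>}"
        using t by (simp add: algebra_simps)
      moreover have "T t = T \<delta> o\<^sub>L T (t - \<delta>)"
        using C0_semigroup_add[OF T, of \<delta> "t - \<delta>"] \<delta> False by simp
      then have "norm (T t) \<le> norm (T \<delta>) * norm (T (t - \<delta>))"
        by (simp add: norm_blinfun_compose)
      ultimately have "norm (T t) \<le> M * K"
        using M[of \<delta>] K \<delta> M0 by (smt (verit) atLeastAtMost_iff mult_mono norm_ge_zero)
      then show ?thesis by simp
    qed
    then show ?case by blast
  qed (use C0_semigroup_zero[OF T] in auto)
  moreover obtain n where "b \<le> real n * \<delta>"
    using reals_Archimedean3[OF \<delta>] less_imp_le by blast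
  ultimately show thesis
    using that by (meson atLeastAtMost_iff order_trans)
qed

text \<open>Right continuity at 0 yields two-sided continuity: factoring out the operator at the
  smaller of two times leaves an increment of the orbit at 0, and the factor is locally
  bounded.\<close>

lemma C0_semigroup_continuous_on:
  fixes T :: "real \<Rightarrow> 'a::banach \<Rightarrow>\<^sub>L 'a"
  assumes T: "C0_semigroup T"
  shows "continuous_on {0..} (\<lambda>t. blinfun_apply (T t) x)"
  unfolding continuous_on_def
proof
  fix t :: real
  assume "t \<in> {0..}"
  then have t: "0 \<le> t" by simp
  obtain M where M: "\<And>s. s \<in> {0..t + 1} \<Longrightarrow> norm (T s) \<le> M"
    using C0_semigroup_locally_bounded[OF T] by metis
  \<comment> \<open>Only the smaller time \<open>u\<close> has to lie where \<open>M\<close> is a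
    bound, so \<open>v\<close> is unrestricted above and \<open>bound\<close> holds for every
    \<open>s\<close> \<ge> 0.\<close>
  have ordered: "norm (blinfun_apply (T v) x - blinfun_apply (T u) x)
      \<le> M * norm (blinfun_apply (T (v - u)) x - x)"
    if "0 \<le> u" "u \<le> v" "u \<le> t + 1" for u v
  proof -
    have "T v = T u o\<^sub>L T (v - u)"
      using C0_semigroup_add[OF T, of u "v - u"] that by simp
    then have "blinfun_apply (T v) x - blinfun_apply (T u) x =
        blinfun_apply (T u) (blinfun_apply (T (v - u)) x - x)"
      by (simp add: blinfun.diff_right)
    also have "norm \<dots> \<le> norm (T u) * norm (blinfun_apply (T (v - u)) x - x)"
      by (rule norm_blinfun)
    also have "\<dots> \<le> M * norm (blinfun_apply (T (v - u)) x - x)"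
      using M that by (intro mult_right_mono) auto
    finally show ?thesis .
  qed
  have bound: "norm (blinfun_apply (T s) x - blinfun_apply (T t) x)
      \<le> M * norm (blinfun_apply (T \<bar>s - t\<bar>) x - x)" if "0 \<le> s" for s
    using ordered[of s t] ordered[of t s] t that
    by (cases "s \<le> t") (simp_all add: norm_minus_commute)
  have "((\<lambda>s. \<bar>s - t\<bar>) \<longlongrightarrow> 0) (at t within {0..})"
    by (auto intro!: tendsto_eq_intros)
  \<comment> \<open>The filter omits \<open>s = t\<close>, so the distance is strictly
    positive.\<close>
  then have "filterlim (\<lambda>s. \<bar>s - t\<bar>) (at_right 0) (at t within {0..})"
    by (auto simp: filterlim_at eventually_at_filter)
  then have "((\<lambda>s. blinfun_apply (T \<bar>s - t\<bar>) x) \<longlongrightarrow> x) (at t within {0..})"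
    by (rule filterlim_compose[OF C0_semigroup_tendsto[OF T]])
  then have "((\<lambda>s. M * norm (blinfun_apply (T \<bar>s - t\<bar>) x - x)) \<longlongrightarrow> 0) (at t within {0..})"
    by (intro tendsto_mult_right_zero tendsto_norm_zero) (simp add: Lim_null[symmetric])
  then have "((\<lambda>s. blinfun_apply (T s) x - blinfun_apply (T t) x) \<longlongrightarrow> 0) (at t within {0..})"
    by (rule Lim_null_comparison[rotated]) (auto simp: eventually_at_filter bound)
  then show "((\<lambda>s. blinfun_apply (T s) x) \<longlongrightarrow> blinfun_apply (T t) x) (at t within {0..})"
    by (simp add: Lim_null[symmetric])
qed

text \<open>Tonelli: \<open>s\<close> lies in the window ending at \<open>r\<close> exactly when
  \<open>r\<close> lies in \<open>{s..s + a}\<close>, an interval of length \<open>a\<close>, so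
  every value \<open>f s\<close> receives weight \<open>a\<close>.\<close>

lemma nn_integral_moving_window:
  fixes f :: "real \<Rightarrow> ennreal"
  assumes [measurable]: "f \<in> borel_measurable borel" and "0 \<le> a"
  shows "(\<integral>\<^sup>+r. (\<integral>\<^sup>+s\<in>{r - a..r}. f s \<partial>lborel) \<partial>lborel) = ennreal a * (\<integral>\<^sup>+s. f s \<partial>lborel)"
proof -
  have indicator_swap: "(indicator {r - a..r} s :: ennreal) = indicator {s..s + a} r" for r s :: real
    by (auto simp: indicator_def)
  have meas: "(\<lambda>(r, s). f s * indicator {s..s + a} r) \<in> borel_measurable (lborel \<Otimes>\<^sub>M lborel)"
    unfolding indicator_def atLeastAtMost_iff by measurable
  have "(\<integral>\<^sup>+r. (\<integral>\<^sup>+s\<in>{r - a..r}. f s \<partial>lborel) \<partial>lborel) =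
      (\<integral>\<^sup>+s. (\<integral>\<^sup>+r. f s * indicator {s..s + a} r \<partial>lborel) \<partial>lborel)"
    unfolding indicator_swap using lborel_pair.Fubini'[OF meas] by simp
  also have "\<dots> = (\<integral>\<^sup>+s. f s * ennreal a \<partial>lborel)"
    using assms(2) by (simp add: nn_integral_cmult_indicator)
  also have "\<dots> = ennreal a * (\<integral>\<^sup>+s. f s \<partial>lborel)"
    by (subst nn_integral_multc) (simp_all add: mult.commute)
  finally show ?thesis .
qed

theorem theorem7:
  fixes T :: "real \<Rightarrow> 'a::banach \<Rightarrow>\<^sub>L 'a"
    and D :: "'a set" and A :: "'a \<Rightarrow> 'a"
    and C :: "'a \<Rightarrow>\<^sub>L 'n::{real_inner, complete_space}"
    and t\<^sub>0 :: real
  assumes "reflexive_space TYPE('a)"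
    and "C0_semigroup T"
    and "is_generator D A T"
    and "t\<^sub>0 > 0"
    and "continuously_finally_observable C T t\<^sub>0"
  shows "detectable_L2 C T"
  unfolding detectable_L2_def
proof (intro allI impI)
  fix x
  assume fin: "(\<integral>\<^sup>+t\<in>{0..}. ennreal ((norm (blinfun_apply C (blinfun_apply (T t) x)))\<^sup>2) \<partial>lborel) < \<infinity>"
  note T = \<open>C0_semigroup T\<close>
  obtain \<epsilon> where \<epsilon>: "\<epsilon> > 0" and obs: "\<And>y. ennreal (\<epsilon> * (norm (blinfun_apply (T t\<^sub>0) y))\<^sup>2) \<le>
      (\<integral>\<^sup>+t\<in>{0..t\<^sub>0}. ennreal ((norm (blinfun_apply C (blinfun_apply (T t) y)))\<^sup>2) \<partial>lborel)"
    using assms(5) unfolding continuously_finally_observable_def by blast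
  \<comment> \<open>Freezing the orbit at its initial value for negative times makes it continuous,
    and the integrands Borel measurable, on the whole line.\<close>
  define u where "u t = blinfun_apply (T (max 0 t)) x" for t
  have "continuous_on UNIV u"
    unfolding u_def
    by (rule continuous_on_compose2[OF C0_semigroup_continuous_on[OF T]])
      (auto intro!: continuous_intros)
  then have "continuous_on UNIV (\<lambda>t. (norm (u t))\<^sup>2)"
    "continuous_on UNIV (\<lambda>t. (norm (blinfun_apply C (u t)))\<^sup>2)"
    by (auto intro!: continuous_intros)
  then have [measurable]: "(\<lambda>t. (norm (u t))\<^sup>2) \<in> borel_measurable borel"
    "(\<lambda>t. (norm (blinfun_apply C (u t)))\<^sup>2) \<in> borel_measurable borel"
    by (auto intro: borel_measurable_continuous_onI)
  define g where "g t = ennreal ((norm (u t))\<^sup>2)" for t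
  define f where "f t = ennreal ((norm (blinfun_apply C (u t)))\<^sup>2) * indicator {0..} t" for t
  have [measurable]: "g \<in> borel_measurable borel" "f \<in> borel_measurable borel"
    unfolding g_def f_def by measurable
  have output_finite: "(\<integral>\<^sup>+t. f t \<partial>lborel) < \<infinity>"
  proof -
    have "f t = ennreal ((norm (blinfun_apply C (blinfun_apply (T t) x)))\<^sup>2) * indicator {0..} t" for t
      by (simp add: f_def u_def indicator_def)
    then show ?thesis using fin by simp
  qed
  \<comment> \<open>Observability is applied to the state at time \<open>r - t\<^sub>0\<close>,
    which is nonnegative; its final state is then \<open>u r\<close>, and translating time turns
    \<open>{0..t\<^sub>0}\<close> into the window ending at \<open>r\<close>.\<close>
  have window: "ennreal \<epsilon> * g r \<le> (\<integral>\<^sup>+s\<in>{r - t\<^sub>0..r}. f s \<partial>lborel)" if r: "t\<^sub>0 \<le> r" for r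
  proof -
    define s where "s = r - t\<^sub>0"
    have s: "0 \<le> s" "r = t\<^sub>0 + s" using r by (auto simp: s_def)
    have shift: "blinfun_apply (T t) (u s) = u (s + t)" if "0 \<le> t" for t
      using C0_semigroup_add[OF T, of t s] that s by (simp add: u_def add.commute)
    have "ennreal \<epsilon> * g r = ennreal (\<epsilon> * (norm (blinfun_apply (T t\<^sub>0) (u s)))\<^sup>2)"
      using \<epsilon> s \<open>t\<^sub>0 > 0\<close> by (simp add: shift g_def ennreal_mult' add.commute)
    also have "\<dots> \<le> (\<integral>\<^sup>+t\<in>{0..t\<^sub>0}. ennreal ((norm (blinfun_apply C (blinfun_apply (T t) (u s))))\<^sup>2) \<partial>lborel)"
      by (rule obs)
    also have "\<dots> = (\<integral>\<^sup>+t. f (s + 1 * t) * indicator {r - t\<^sub>0..r} (s + 1 * t) \<partial>lborel)"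
      using s by (intro nn_integral_cong) (auto simp: indicator_def f_def shift)
    also have "\<dots> = (\<integral>\<^sup>+s\<in>{r - t\<^sub>0..r}. f s \<partial>lborel)"
      by (subst nn_integral_real_affine[where c = 1 and t = s]) auto
    finally show ?thesis .
  qed
  have "ennreal \<epsilon> * (\<integral>\<^sup>+t\<in>{t\<^sub>0..}. g t \<partial>lborel) = (\<integral>\<^sup>+t\<in>{t\<^sub>0..}. ennreal \<epsilon> * g t \<partial>lborel)"
    by (simp add: nn_integral_cmult[symmetric] mult.assoc)
  \<comment> \<open>Beyond the pointwise window bound, the outer integral is enlarged from
    \<open>{t\<^sub>0..}\<close> to all \<open>r\<close>, where the integrand is
    nonnegative.\<close>
  also have "\<dots> \<le> (\<integral>\<^sup>+r. (\<integral>\<^sup>+s\<in>{r - t\<^sub>0..r}. f s \<partial>lborel) \<partial>lborel)"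
    by (intro nn_integral_mono) (metis indicator_simps mult.right_neutral mult_zero_right atLeast_iff window zero_le)
  also have "\<dots> = ennreal t\<^sub>0 * (\<integral>\<^sup>+t. f t \<partial>lborel)"
    using \<open>t\<^sub>0 > 0\<close> by (intro nn_integral_moving_window) auto
  also have "\<dots> < \<infinity>"
    using output_finite by (simp add: ennreal_mult_less_top)
  \<comment> \<open>Positivity of \<open>\<epsilon>\<close> allows the factor to be cancelled from
    the finite product.\<close>
  finally have tail: "(\<integral>\<^sup>+t\<in>{t\<^sub>0..}. g t \<partial>lborel) < \<infinity>"
    using \<epsilon> by (auto simp: ennreal_mult_less_top)
  obtain M where M: "\<And>t. t \<in> {0..t\<^sub>0} \<Longrightarrow> norm (T t) \<le> M"
    using C0_semigroup_locally_bounded[OF T] by metis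
  have "(\<integral>\<^sup>+t\<in>{0..t\<^sub>0}. g t \<partial>lborel) \<le> (\<integral>\<^sup>+t\<in>{0..t\<^sub>0}. ennreal ((M * norm x)\<^sup>2) \<partial>lborel)"
  proof (intro nn_integral_mono)
    fix t
    have "norm (u t) \<le> M * norm x" if "t \<in> {0..t\<^sub>0}"
      using norm_blinfun[of "T t" x] mult_right_mono[OF M[OF that], of "norm x"] that
      by (simp add: u_def)
    then show "g t * indicator {0..t\<^sub>0} t \<le> ennreal ((M * norm x)\<^sup>2) * indicator {0..t\<^sub>0} t"
      by (auto simp: indicator_def g_def intro!: ennreal_leI power_mono)
  qed
  also have "\<dots> < \<infinity>"
    using \<open>t\<^sub>0 > 0\<close> by (simp add: nn_integral_cmult_indicator ennreal_mult_less_top)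
  finally have head: "(\<integral>\<^sup>+t\<in>{0..t\<^sub>0}. g t \<partial>lborel) < \<infinity>" .
  \<comment> \<open>The pieces overlap at \<open>t\<^sub>0\<close>, so the splitting is an upper
    bound pointwise.\<close>
  have "(\<integral>\<^sup>+t\<in>{0..}. ennreal ((norm (blinfun_apply (T t) x))\<^sup>2) \<partial>lborel) \<le>
      (\<integral>\<^sup>+t. g t * indicator {0..t\<^sub>0} t + g t * indicator {t\<^sub>0..} t \<partial>lborel)"
    by (intro nn_integral_mono) (auto simp: indicator_def g_def u_def)
  also have "\<dots> = (\<integral>\<^sup>+t\<in>{0..t\<^sub>0}. g t \<partial>lborel) + (\<integral>\<^sup>+t\<in>{t\<^sub>0..}. g t \<partial>lborel)"
    by (intro nn_integral_add) auto
  also have "\<dots> < \<infinity>"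
    using head tail by simp
  finally show "(\<integral>\<^sup>+t\<in>{0..}. ennreal ((norm (blinfun_apply (T t) x))\<^sup>2) \<partial>lborel) < \<infinity>" .
qed

end
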